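(* Let $N$ be a Novikov algebra over a field $K$ and let $G$ be a finite solvable group of automorphisms of $N$. If the algebra of invariants $N^G$ is solvable and the characteristic of $K$ does not divide the order of $G$, then $N$ is solvable.
   Context: A (nonassociative) algebra $N$ over a field $K$ is a Novikov algebra if $(x,y,z)=(y,x,z)$ and $(xy)z=(xz)y$ for all $x,y,z\in N$, where $(x,y,z)=(xy)z-x(yz)$. Automorphisms are $K$-algebra automorphisms. $N^G=\{x\in N\mid \phi(x)=x \text{ for all }\phi\in G\}$, a subalgebra of $N$. For subspaces $U,V$, the product $UV$ is the linear span of all $uv$ with $u\in U$, $v\in V$. The derived powers of an algebra $A$ are $A^{(0)}=A$, $A^{(m)}=A^{(m-1)}A^{(m-1)}$ for $m\ge 1$; $A$ is solvable if $A^{(m)}=0$ for some positive integer $m$. The condition that the characteristic of $K$ does not divide $|G|$ means that the characteristic is $0$ or a prime $p$ not dividing $|G|$. *)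

theory Defs
  imports Complex_Main "HOL-Algebra.Bij" "HOL-Algebra.Solvable_Groups"
begin

definition invariants :: "('a \<Rightarrow> 'a) set \<Rightarrow> 'a set"
  where "invariants G = {x. \<forall>\<phi>\<in>G. \<phi> x = x}"

locale nonassoc_algebra = vector_space scale
  for scale :: "'k::field \<Rightarrow> 'a::ab_group_add \<Rightarrow> 'a" (infixr \<open>*s\<close> 75) +
  fixes mul :: "'a \<Rightarrow> 'a \<Rightarrow> 'a" (infixl \<open>\<cdot>\<close> 70)
  assumes linear_mul_left: "Vector_Spaces.linear scale scale (\<lambda>x. x \<cdot> y)"
    and linear_mul_right: "Vector_Spaces.linear scale scale (\<lambda>y. x \<cdot> y)"
begin

definition associator :: "'a \<Rightarrow> 'a \<Rightarrow> 'a \<Rightarrow> 'a"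
  where "associator x y z = (x \<cdot> y) \<cdot> z - x \<cdot> (y \<cdot> z)"

definition set_prod :: "'a set \<Rightarrow> 'a set \<Rightarrow> 'a set"
  where "set_prod U V = span {u \<cdot> v | u v. u \<in> U \<and> v \<in> V}"

primrec derived_power :: "'a set \<Rightarrow> nat \<Rightarrow> 'a set" where
  "derived_power A 0 = A"
| "derived_power A (Suc m) = set_prod (derived_power A m) (derived_power A m)"

text \<open>The argument is the carrier of a subalgebra; the whole algebra is \<^term>\<open>UNIV\<close>.
  The name avoids a clash with solvability of groups.\<close>

definition solvable_alg :: "'a set \<Rightarrow> bool"
  where "solvable_alg A \<longleftrightarrow> (\<exists>m>0. derived_power A m = {0})"

definition alg_auto :: "('a \<Rightarrow> 'a) set"
  where "alg_auto = {\<phi>. bij \<phi> \<and> Vector_Spaces.linear scale scale \<phi> \<and>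
    (\<forall>x y. \<phi> (x \<cdot> y) = \<phi> x \<cdot> \<phi> y)}"

text \<open>On \<^term>\<open>UNIV\<close> the extensionality required by \<^const>\<open>Bij\<close> is vacuous, so the group
  operation is composition of functions.\<close>

definition AlgAutGroup :: "('a \<Rightarrow> 'a) monoid"
  where "AlgAutGroup = BijGroup UNIV \<lparr>carrier := alg_auto\<rparr>"

lemma subgroup_alg_auto: "subgroup alg_auto (BijGroup (UNIV :: 'a set))"
proof (rule subgroup.intro)
  show sub: "alg_auto \<subseteq> carrier (BijGroup (UNIV :: 'a set))"
    by (auto simp: alg_auto_def BijGroup_def Bij_def)
  show "\<one>\<^bsub>BijGroup (UNIV :: 'a set)\<^esub> \<in> alg_auto"
    using linear_ident by (simp add: alg_auto_def BijGroup_def restrict_UNIV bij_id[unfolded id_def])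
  show "f \<otimes>\<^bsub>BijGroup (UNIV :: 'a set)\<^esub> g \<in> alg_auto" if "f \<in> alg_auto" "g \<in> alg_auto" for f g
  proof -
    have b: "bij f" "bij g" and l: "Vector_Spaces.linear scale scale f" "Vector_Spaces.linear scale scale g"
      and m: "\<And>x y. f (x \<cdot> y) = f x \<cdot> f y" "\<And>x y. g (x \<cdot> y) = g x \<cdot> g y"
      using that by (auto simp: alg_auto_def)
    have "bij (f \<circ> g)"
      using b(2,1) by (rule bij_comp)
    moreover have "Vector_Spaces.linear scale scale (f \<circ> g)"
      using l(2,1) by (rule Vector_Spaces.linear_compose)
    moreover have "f \<otimes>\<^bsub>BijGroup (UNIV :: 'a set)\<^esub> g = f \<circ> g"
      using b by (simp add: BijGroup_def Bij_def compose_def restrict_UNIV comp_def)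
    ultimately show ?thesis
      by (simp add: alg_auto_def m)
  qed
  show "inv\<^bsub>BijGroup (UNIV :: 'a set)\<^esub> f \<in> alg_auto" if f: "f \<in> alg_auto" for f
  proof -
    have b: "bij f" and l: "Vector_Spaces.linear scale scale f"
      and m: "\<And>x y. f (x \<cdot> y) = f x \<cdot> f y"
      using f by (auto simp: alg_auto_def)
    have ff: "f (inv_into UNIV f x) = x" for x
      using b by (simp add: bij_is_surj surj_f_inv_f)
    have inj: "u = v" if "f u = f v" for u v
      using b that by (simp add: bij_is_inj inj_eq)
    have "Vector_Spaces.linear scale scale (inv_into UNIV f)"
      unfolding Vector_Spaces.linear_iff
    proof (intro conjI allI)
      show "inv_into UNIV f (x + y) = inv_into UNIV f x + inv_into UNIV f y" for x y
        using l by - (rule inj, simp add: Vector_Spaces.linear_iff ff)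
      show "inv_into UNIV f (c *s x) = c *s inv_into UNIV f x" for c x
        using l by - (rule inj, simp add: Vector_Spaces.linear_iff ff)
    qed (fact vector_space_axioms)+
    moreover have "inv_into UNIV f (x \<cdot> y) = inv_into UNIV f x \<cdot> inv_into UNIV f y" for x y
      by (rule inj) (simp add: m ff)
    moreover have "inv\<^bsub>BijGroup (UNIV :: 'a set)\<^esub> f = inv_into UNIV f"
      using b by (subst inv_BijGroup) (simp_all add: Bij_def restrict_UNIV)
    ultimately show ?thesis
      using b by (simp add: alg_auto_def bij_imp_bij_inv)
  qed
qed

lemma group_AlgAutGroup: "group AlgAutGroup"
  unfolding AlgAutGroup_def
  by (rule subgroup.subgroup_is_group[OF subgroup_alg_auto group_BijGroup])

end

locale novikov_algebra = nonassoc_algebra +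
  assumes left_symmetric: "associator x y z = associator y x z"
    and right_commutative: "(x \<cdot> y) \<cdot> z = (x \<cdot> z) \<cdot> y"

end

theory Submission
  imports Defs
begin

text \<open>
  Let \<open>R y\<close> and \<open>L y\<close> be the operators \<open>w \<mapsto> w y\<close> and \<open>w \<mapsto> y w\<close>. Right commutativity says that the
  \<open>R y\<close> commute, so they generate a commutative ring \<open>A\<close> of operators, and the algebra is solvable as
  soon as all products of sufficiently many \<open>R y\<close> vanish (\<open>nil_mod_imp_solvable\<close>). Left symmetry
  says that \<open>[L y, R z] = R (y z) - R y R z\<close>. Hence \<open>ad y = [L y, _]\<close> is a derivation of \<open>A\<close>, and
  \<open>R (f y) = f R y + ad y f\<close> for all \<open>f\<close> in \<open>A\<close> (\<open>Rop_app\<close>): for fixed \<open>y\<close>, \<open>R (f y)\<close> is a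
  first-order differential operator in \<open>f\<close>. Automorphisms act on \<open>A\<close> by conjugation.

  A solvable subalgebra \<open>B\<close> generates a nilpotent ideal of \<open>A\<close> (\<open>solvable_imp_nil_mod\<close>), because
  threefold products of the \<open>R b\<close> with \<open>b \<in> B\<close> lie in the ideal generated by the \<open>R c\<close> with
  \<open>c \<in> B B\<close>. Apply this to the invariants to get a nilpotent ideal \<open>J\<close>. What remains is
  that the ideal generated by all \<open>R y\<close> is nilpotent modulo \<open>J\<close>.

  The idea is best seen for a prime ideal \<open>Q\<close> of \<open>A\<close> containing \<open>J\<close>. Let \<open>H\<close> consist of the \<open>g\<close> in
  \<open>G\<close> that act trivially modulo \<open>Q\<close>. As \<open>\<Sum>g. g (f y)\<close> is invariant, \<open>\<Sum>g. R (g (f y))\<close> lies in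
  \<open>Q\<close> for all \<open>f\<close>. Each summand is a first-order operator in \<open>f\<close>, twisted by \<open>g\<close>. Replacing
  \<open>F f\<close> by \<open>F (w f) - (g w) F f\<close> twice annihilates the summand of \<open>g\<close>, while on the untwisted
  summand its principal effect is multiplication by \<open>w - g w\<close>, which can be chosen outside \<open>Q\<close> if
  \<open>g\<close> is not in \<open>H\<close>. The summands for \<open>g \<in> H\<close> all agree modulo \<open>Q\<close>, so what survives is \<open>|H| R (f y)\<close>.
  Since \<open>|H|\<close> divides \<open>|G|\<close> and is invertible, \<open>f = 1\<close> gives \<open>R y \<in> Q\<close> for all \<open>y\<close>.

  Primes only give that the operators are nilpotent one by one. To make the argument
  uniform, a prime is replaced by a pair of ideals \<open>Y\<close> and \<open>Q\<close> such that, for every \<open>g\<close>, the ideal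
  generated by all \<open>w - g w\<close> contains \<open>Y\<close> or is contained in \<open>Q\<close>; elements of \<open>Y\<close> take the place of
  elements outside the prime. By \<open>nil_mod_dichotomy\<close> it suffices to
  treat such pairs, \<open>eliminate\<close> is the elimination of the summands outside \<open>H\<close>, and
  \<open>nil_mod_inertia\<close> concludes that \<open>Y\<close> is nilpotent modulo \<open>Q\<close>.
\<close>

section \<open>Nilpotency modulo ideals in a commutative ring\<close>

text \<open>The commutative ring is a subset of a noncommutative one because it will consist of operators.
  The sort avoids \<open>ring_1\<close>, which would exclude the endomorphisms of a trivial group.\<close>

locale comm_subring =
  fixes A :: "'r::{ring, monoid_mult} set"
  assumes one_mem [simp]: "1 \<in> A"
    and add_mem [simp]: "a \<in> A \<Longrightarrow> b \<in> A \<Longrightarrow> a + b \<in> A"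
    and uminus_mem [simp]: "a \<in> A \<Longrightarrow> - a \<in> A"
    and mult_mem [simp]: "a \<in> A \<Longrightarrow> b \<in> A \<Longrightarrow> a * b \<in> A"
    and commute: "a \<in> A \<Longrightarrow> b \<in> A \<Longrightarrow> a * b = b * a"
begin

lemma diff_mem [simp]: "a \<in> A \<Longrightarrow> b \<in> A \<Longrightarrow> a - b \<in> A"
  using add_mem[of a "- b"] by simp

lemma zero_mem [simp]: "0 \<in> A"
  using diff_mem[of 1 1] by simp

lemma left_commute: "a \<in> A \<Longrightarrow> b \<in> A \<Longrightarrow> a * (b * c) = b * (a * c)"
  by (metis commute mult.assoc)

lemma prod_list_mem: "set xs \<subseteq> A \<Longrightarrow> prod_list xs \<in> A"
  by (induction xs) auto

definition is_ideal :: "'r set \<Rightarrow> bool" where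
  "is_ideal I \<longleftrightarrow> I \<subseteq> A \<and> 0 \<in> I \<and> (\<forall>a\<in>I. \<forall>b\<in>I. a + b \<in> I) \<and> (\<forall>a\<in>A. \<forall>b\<in>I. a * b \<in> I)"

lemma is_idealI:
  assumes "I \<subseteq> A" "0 \<in> I" "\<And>a b. a \<in> I \<Longrightarrow> b \<in> I \<Longrightarrow> a + b \<in> I"
    and "\<And>a b. a \<in> A \<Longrightarrow> b \<in> I \<Longrightarrow> a * b \<in> I"
  shows "is_ideal I"
  using assms by (auto simp: is_ideal_def)

lemma ideal_subset: "is_ideal I \<Longrightarrow> I \<subseteq> A"
  by (simp add: is_ideal_def)

lemma ideal_mem: "is_ideal I \<Longrightarrow> a \<in> I \<Longrightarrow> a \<in> A"
  by (auto simp: is_ideal_def)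

lemma ideal_zero: "is_ideal I \<Longrightarrow> 0 \<in> I"
  by (simp add: is_ideal_def)

lemma ideal_add: "is_ideal I \<Longrightarrow> a \<in> I \<Longrightarrow> b \<in> I \<Longrightarrow> a + b \<in> I"
  by (simp add: is_ideal_def)

lemma ideal_mult_left: "is_ideal I \<Longrightarrow> a \<in> A \<Longrightarrow> b \<in> I \<Longrightarrow> a * b \<in> I"
  by (simp add: is_ideal_def)

lemma ideal_mult_right: "is_ideal I \<Longrightarrow> a \<in> A \<Longrightarrow> b \<in> I \<Longrightarrow> b * a \<in> I"
  by (metis commute ideal_mem ideal_mult_left)

lemma ideal_uminus: "is_ideal I \<Longrightarrow> a \<in> I \<Longrightarrow> - a \<in> I"
  using ideal_mult_left[of I "- 1" a] by simp

lemma ideal_diff: "is_ideal I \<Longrightarrow> a \<in> I \<Longrightarrow> b \<in> I \<Longrightarrow> a - b \<in> I"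
  using ideal_add[of I a "- b"] ideal_uminus[of I b] by simp

lemma ideal_sum: "is_ideal I \<Longrightarrow> (\<And>x. x \<in> S \<Longrightarrow> f x \<in> I) \<Longrightarrow> sum f S \<in> I"
  by (induction S rule: infinite_finite_induct) (auto simp: ideal_zero ideal_add)

lemma ideal_inter: "is_ideal I \<Longrightarrow> is_ideal J \<Longrightarrow> is_ideal (I \<inter> J)"
  by (auto simp: is_ideal_def)

definition ideal_plus :: "'r set \<Rightarrow> 'r set \<Rightarrow> 'r set" where
  "ideal_plus I J = {a + b | a b. a \<in> I \<and> b \<in> J}"

lemma ideal_plus_ideal:
  assumes "is_ideal I" "is_ideal J"
  shows "is_ideal (ideal_plus I J)"
proof (rule is_idealI)
  show "ideal_plus I J \<subseteq> A"
    using assms by (auto simp: ideal_plus_def intro!: add_mem intro: ideal_mem)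
  show "0 \<in> ideal_plus I J"
    using assms ideal_zero unfolding ideal_plus_def by force
next
  fix x y assume "x \<in> ideal_plus I J" "y \<in> ideal_plus I J"
  then obtain a b c d where "x = a + b" "y = c + d" "a \<in> I" "b \<in> J" "c \<in> I" "d \<in> J"
    by (auto simp: ideal_plus_def)
  moreover have "(a + b) + (c + d) = (a + c) + (b + d)" by (simp add: algebra_simps)
  ultimately show "x + y \<in> ideal_plus I J"
    using assms ideal_add unfolding ideal_plus_def by blast
next
  fix x y assume "x \<in> A" "y \<in> ideal_plus I J"
  then obtain a b where "y = a + b" "a \<in> I" "b \<in> J" by (auto simp: ideal_plus_def)
  moreover from this have "x * a \<in> I" "x * b \<in> J"
    using assms ideal_mult_left \<open>x \<in> A\<close> by auto
  ultimately show "x * y \<in> ideal_plus I J"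
    unfolding ideal_plus_def by (auto simp: distrib_left)
qed

lemma subset_ideal_plus:
  assumes "is_ideal I" "is_ideal J"
  shows "I \<subseteq> ideal_plus I J" "J \<subseteq> ideal_plus I J"
  using assms ideal_zero unfolding ideal_plus_def by force+

definition gen :: "'r set \<Rightarrow> 'r set" where
  "gen S = \<Inter>{I. is_ideal I \<and> S \<subseteq> I}"

lemma subset_gen: "S \<subseteq> gen S"
  by (auto simp: gen_def)

lemma gen_least: "is_ideal I \<Longrightarrow> S \<subseteq> I \<Longrightarrow> gen S \<subseteq> I"
  by (auto simp: gen_def)

lemma is_ideal_A: "is_ideal A"
  by (auto intro!: is_idealI)

lemma gen_ideal:
  assumes "S \<subseteq> A"
  shows "is_ideal (gen S)"
proof (rule is_idealI)
  show "gen S \<subseteq> A" using gen_least[OF is_ideal_A assms] .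
qed (auto simp: gen_def ideal_zero ideal_add ideal_mult_left)

text \<open>The ideal quotient: it turns statements about all elements of a generated ideal into
  statements about its generators.\<close>

lemma ideal_colon:
  assumes "is_ideal P" "b \<in> A"
  shows "is_ideal {a \<in> A. a * b \<in> P}"
  using assms
  by (auto intro!: is_idealI simp: distrib_right mult.assoc ideal_zero ideal_add ideal_mult_left)

lemma gen_mult_mem:
  assumes "is_ideal P" "S \<subseteq> A" "b \<in> A" "\<And>s. s \<in> S \<Longrightarrow> s * b \<in> P" "a \<in> gen S"
  shows "a * b \<in> P"
proof -
  have "gen S \<subseteq> {a \<in> A. a * b \<in> P}"
    using assms by (intro gen_least ideal_colon) auto
  then show ?thesis using assms(5) by auto
qed

text \<open>For ideals \<open>X\<close> and \<open>P\<close>, this says that some power of \<open>X\<close> lies in \<open>P\<close>. It is stated for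
  arbitrary sets so that it can be checked on generators (\<open>nil_mod_gen\<close> below).\<close>

definition nil_mod :: "'r set \<Rightarrow> 'r set \<Rightarrow> bool" where
  "nil_mod X P \<longleftrightarrow> (\<exists>m. \<forall>xs. length xs = m \<and> set xs \<subseteq> X \<longrightarrow> prod_list xs \<in> P)"

lemma nil_mod_blocks:
  assumes "\<And>xs. length xs = m \<Longrightarrow> set xs \<subseteq> X \<Longrightarrow> prod_list xs \<in> Y"
    and "length xs = m * k" "set xs \<subseteq> X"
  shows "\<exists>ys. length ys = k \<and> set ys \<subseteq> Y \<and> prod_list xs = prod_list ys"
  using assms(2,3)
proof (induction k arbitrary: xs)
  case 0
  then show ?case by auto
next
  case (Suc k)
  have "length (drop m xs) = m * k" "set (drop m xs) \<subseteq> X"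
    using Suc.prems set_drop_subset[of m xs] by auto
  from Suc.IH[OF this] obtain ys
    where ys: "length ys = k" "set ys \<subseteq> Y" "prod_list (drop m xs) = prod_list ys" by auto
  have "prod_list (take m xs) \<in> Y"
    using Suc.prems set_take_subset[of m xs] by (intro assms(1)) auto
  moreover have "prod_list xs = prod_list (take m xs) * prod_list (drop m xs)"
    by (metis append_take_drop_id prod_list.append)
  ultimately show ?case
    using ys by (intro exI[of _ "prod_list (take m xs) # ys"]) auto
qed

lemma nil_mod_trans:
  assumes "nil_mod X Y" "nil_mod Y P"
  shows "nil_mod X P"
proof -
  obtain m where m: "\<And>xs. length xs = m \<Longrightarrow> set xs \<subseteq> X \<Longrightarrow> prod_list xs \<in> Y"
    using assms(1) by (auto simp: nil_mod_def)
  obtain k where k: "\<And>xs. length xs = k \<Longrightarrow> set xs \<subseteq> Y \<Longrightarrow> prod_list xs \<in> P"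
    using assms(2) by (auto simp: nil_mod_def)
  have "prod_list xs \<in> P" if "length xs = m * k" "set xs \<subseteq> X" for xs
    using nil_mod_blocks[of m X Y xs k] m k that by metis
  then show ?thesis by (auto simp: nil_mod_def)
qed

lemma nil_mod_gen:
  assumes "nil_mod S P" "S \<subseteq> A" "is_ideal P"
  shows "nil_mod (gen S) P"
proof -
  obtain m where m: "\<And>xs. length xs = m \<Longrightarrow> set xs \<subseteq> S \<Longrightarrow> prod_list xs \<in> P"
    using assms(1) by (auto simp: nil_mod_def)
  have genA: "gen S \<subseteq> A"
    using assms(2) gen_ideal ideal_subset by blast
  \<comment> \<open>The generators are replaced by elements of the ideal one factor at a time.\<close>
  have "prod_list (xs @ ys) \<in> P"
    if "length xs + length ys = m" "set xs \<subseteq> gen S" "set ys \<subseteq> S" for xs ys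
    using that
  proof (induction xs arbitrary: ys)
    case Nil
    then show ?case using m by simp
  next
    case (Cons x xs)
    have A: "prod_list xs \<in> A" "prod_list ys \<in> A"
      using Cons.prems genA assms(2) by (auto intro!: prod_list_mem)
    have "x * (prod_list xs * prod_list ys) \<in> P"
    proof (rule gen_mult_mem[OF assms(3,2)])
      show "prod_list xs * prod_list ys \<in> A" "x \<in> gen S" using A Cons.prems by auto
    next
      fix s assume s: "s \<in> S"
      then have "prod_list (xs @ s # ys) \<in> P" using Cons.prems by (intro Cons.IH) auto
      moreover have "prod_list (xs @ s # ys) = s * (prod_list xs * prod_list ys)"
        using left_commute[of "prod_list xs" s] A s assms(2) by auto
      ultimately show "s * (prod_list xs * prod_list ys) \<in> P" by simp
    qed
    then show ?case by (simp add: mult.assoc)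
  qed
  from this[of _ "[]"] show ?thesis by (auto simp: nil_mod_def)
qed

text \<open>The cut rule of the distributive lattice of ideals modulo nilpotency: meet is intersection,
  join is the sum.\<close>

lemma nil_mod_cut:
  assumes X: "is_ideal X" and P: "is_ideal P" and I: "is_ideal I"
    and meet: "nil_mod (X \<inter> I) P" and join: "nil_mod X (ideal_plus P I)"
  shows "nil_mod X P"
proof -
  obtain k where k: "\<And>xs. length xs = k \<Longrightarrow> set xs \<subseteq> X \<Longrightarrow> prod_list xs \<in> ideal_plus P I"
    using join by (auto simp: nil_mod_def)
  \<comment> \<open>One more factor from \<open>X\<close> moves the \<open>I\<close>-component of a \<open>k\<close>-fold product into \<open>X \<inter> I\<close>.\<close>
  have "prod_list xs \<in> ideal_plus P (X \<inter> I)" if xs: "length xs = Suc k" "set xs \<subseteq> X" for xs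
  proof -
    obtain x ys where [simp]: "xs = x # ys" using xs by (cases xs) auto
    obtain p i where pi: "prod_list ys = p + i" "p \<in> P" "i \<in> I"
      using k[of ys] xs by (auto simp: ideal_plus_def)
    have "x * p \<in> P" "x * i \<in> X \<inter> I"
      using pi xs X P I by (auto intro: ideal_mult_left ideal_mult_right ideal_mem)
    then show ?thesis unfolding ideal_plus_def using pi by (auto simp: distrib_left)
  qed
  then have 1: "nil_mod X (ideal_plus P (X \<inter> I))" unfolding nil_mod_def by blast
  obtain m where m: "\<And>xs. length xs = m \<Longrightarrow> set xs \<subseteq> X \<inter> I \<Longrightarrow> prod_list xs \<in> P"
    using meet by (auto simp: nil_mod_def)
  have XI: "is_ideal (X \<inter> I)" using X I by (rule ideal_inter)
  have "\<exists>ys. length ys = length xs \<and> set ys \<subseteq> X \<inter> I \<and> prod_list xs - prod_list ys \<in> P"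
    if "set xs \<subseteq> ideal_plus P (X \<inter> I)" for xs
    using that
  proof (induction xs)
    case Nil
    then show ?case using ideal_zero[OF P] by auto
  next
    case (Cons x xs)
    then obtain p j ys where h: "x = p + j" "p \<in> P" "j \<in> X \<inter> I"
      "length ys = length xs" "set ys \<subseteq> X \<inter> I" "prod_list xs - prod_list ys \<in> P"
      by (auto simp: ideal_plus_def)
    have A: "p \<in> A" "j \<in> A" using h P XI ideal_mem by auto
    have "set xs \<subseteq> A"
      using Cons.prems ideal_subset[OF ideal_plus_ideal[OF P XI]] by auto
    then have xs: "prod_list xs \<in> A" by (rule prod_list_mem)
    have "prod_list (x # xs) - prod_list (j # ys) =
      p * prod_list xs + j * (prod_list xs - prod_list ys)"
      using h by (simp add: algebra_simps)
    also have "\<dots> \<in> P"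
      using P h A xs by (intro ideal_add) (auto intro: ideal_mult_left ideal_mult_right)
    finally show ?case
      using h by (intro exI[of _ "j # ys"]) auto
  qed
  then have "prod_list xs \<in> P" if "length xs = m" "set xs \<subseteq> ideal_plus P (X \<inter> I)" for xs
    using that m ideal_add[OF P] by (metis diff_add_cancel)
  then have "nil_mod (ideal_plus P (X \<inter> I)) P" unfolding nil_mod_def by blast
  with 1 show ?thesis by (rule nil_mod_trans)
qed

text \<open>Iterating the cut rule over \<open>T\<close> decides, for each \<open>g\<close>, on which side of \<open>I g\<close> the pair of ideals
  lies: shrinking \<open>X\<close> to \<open>X \<inter> I g\<close> or enlarging \<open>P\<close> by \<open>I g\<close>. This replaces the choice of a prime
  ideal and keeps the exponent uniform.\<close>

lemma nil_mod_dichotomy: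
  assumes "finite T" "is_ideal X" "is_ideal P" "\<And>g. g \<in> T \<Longrightarrow> is_ideal (I g)"
    and "\<And>Y Q. \<lbrakk>is_ideal Y; is_ideal Q; Y \<subseteq> X; P \<subseteq> Q; \<And>g. g \<in> T \<Longrightarrow> Y \<subseteq> I g \<or> I g \<subseteq> Q\<rbrakk>
      \<Longrightarrow> nil_mod Y Q"
  shows "nil_mod X P"
  using assms
proof (induction T arbitrary: X P rule: finite_induct)
  case empty
  then show ?case by simp
next
  case (insert g T)
  have Ig: "is_ideal (I g)" using insert.prems by simp
  show ?case
  proof (rule nil_mod_cut[OF insert.prems(1,2) Ig])
    show "nil_mod (X \<inter> I g) P"
    proof (rule insert.IH)
      show "is_ideal (X \<inter> I g)" using insert.prems Ig by (simp add: ideal_inter)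
      show "nil_mod Y Q" if "is_ideal Y" "is_ideal Q" "Y \<subseteq> X \<inter> I g" "P \<subseteq> Q"
        "\<And>g. g \<in> T \<Longrightarrow> Y \<subseteq> I g \<or> I g \<subseteq> Q" for Y Q
        using that by (intro insert.prems(4)) auto
    qed (use insert.prems in auto)
    have sub: "P \<subseteq> ideal_plus P (I g)" "I g \<subseteq> ideal_plus P (I g)"
      using subset_ideal_plus insert.prems Ig by auto
    show "nil_mod X (ideal_plus P (I g))"
    proof (rule insert.IH)
      show "is_ideal (ideal_plus P (I g))" using insert.prems Ig by (simp add: ideal_plus_ideal)
      show "nil_mod Y Q" if "is_ideal Y" "is_ideal Q" "Y \<subseteq> X" "ideal_plus P (I g) \<subseteq> Q"
        "\<And>g. g \<in> T \<Longrightarrow> Y \<subseteq> I g \<or> I g \<subseteq> Q" for Y Q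
        using that sub by (intro insert.prems(4)) auto
    qed (use insert.prems in auto)
  qed
qed

section \<open>Eliminating twisted first-order operators\<close>

text \<open>The twisted analogue of \<open>F a = a F 1 + \<delta> a\<close> with a derivation \<open>\<delta>\<close>; for \<open>s\<close> the identity, the
  coefficient \<open>c w\<close> is \<open>\<delta> w\<close>.\<close>

definition first_order :: "('r \<Rightarrow> 'r) \<Rightarrow> ('r \<Rightarrow> 'r) \<Rightarrow> bool" where
  "first_order s F \<longleftrightarrow> (\<forall>a\<in>A. F a \<in> A) \<and>
    (\<exists>c. (\<forall>w\<in>A. c w \<in> A) \<and> (\<forall>w\<in>A. \<forall>a\<in>A. F (w * a) = s w * F a + c w * s a))"

definition twisted_diff :: "('r \<Rightarrow> 'r) \<Rightarrow> 'r \<Rightarrow> ('r \<Rightarrow> 'r) \<Rightarrow> 'r \<Rightarrow> 'r" where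
  "twisted_diff s w F a = F (w * a) - s w * F a"

definition endo_on :: "('r \<Rightarrow> 'r) \<Rightarrow> bool" where
  "endo_on s \<longleftrightarrow> (\<forall>a\<in>A. s a \<in> A) \<and> (\<forall>a\<in>A. \<forall>b\<in>A. s (a * b) = s a * s b)"

text \<open>The coefficient \<open>c v\<close> of \<open>F\<close> becomes \<open>c v (s w - t w)\<close>. For \<open>t = s\<close> it vanishes, which is
  why taking the difference with the own twist twice gives zero (\<open>twisted_diff_twice\<close>).\<close>

lemma first_order_twisted_diff:
  assumes "first_order s F" "endo_on s" "endo_on t" "w \<in> A"
  shows "first_order s (twisted_diff t w F)"
proof -
  obtain c where c: "\<And>w. w \<in> A \<Longrightarrow> c w \<in> A"
      "\<And>w a. w \<in> A \<Longrightarrow> a \<in> A \<Longrightarrow> F (w * a) = s w * F a + c w * s a"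
    and F: "\<And>a. a \<in> A \<Longrightarrow> F a \<in> A"
    using assms(1) unfolding first_order_def by metis
  have s: "\<And>a. a \<in> A \<Longrightarrow> s a \<in> A" "\<And>a. a \<in> A \<Longrightarrow> t a \<in> A"
      "\<And>a b. a \<in> A \<Longrightarrow> b \<in> A \<Longrightarrow> s (a * b) = s a * s b"
    using assms by (auto simp: endo_on_def)
  have "twisted_diff t w F (v * a) = s v * twisted_diff t w F a + (c v * (s w - t w)) * s a"
    if v: "v \<in> A" and a: "a \<in> A" for v a
  proof -
    have "F (w * (v * a)) = s v * F (w * a) + c v * (s w * s a)"
      using c(2)[of v "w * a"] left_commute[of w v a] s(3)[of w a] assms(4) v a by simp
    moreover have "t w * (s v * F a) = s v * (t w * F a)" "t w * (c v * s a) = c v * (t w * s a)"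
      using left_commute s c assms(4) v by auto
    ultimately show ?thesis
      using c(2)[OF v a] by (simp add: twisted_diff_def algebra_simps)
  qed
  moreover have "\<forall>v\<in>A. c v * (s w - t w) \<in> A" using c s assms(4) by auto
  moreover have "\<forall>a\<in>A. twisted_diff t w F a \<in> A"
    using F s assms(4) by (auto simp: twisted_diff_def)
  ultimately show ?thesis
    unfolding first_order_def by (intro conjI exI[of _ "\<lambda>v. c v * (s w - t w)"]) auto
qed

lemma twisted_diff_twice:
  assumes "first_order s F" "endo_on s" "w \<in> A" "v \<in> A" "a \<in> A"
  shows "twisted_diff s v (twisted_diff s w F) a = 0"
proof -
  obtain c where c: "\<And>w. w \<in> A \<Longrightarrow> c w \<in> A"
      "\<And>w a. w \<in> A \<Longrightarrow> a \<in> A \<Longrightarrow> F (w * a) = s w * F a + c w * s a"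
    using assms(1) unfolding first_order_def by metis
  have d: "twisted_diff s w F a = c w * s a" if "a \<in> A" for a
    using c(2)[of w a] that assms by (simp add: twisted_diff_def)
  have "twisted_diff s v (twisted_diff s w F) a = c w * (s v * s a) - s v * (c w * s a)"
    using assms d[of "v * a"] d[of a] unfolding twisted_diff_def[of s v] endo_on_def by simp
  also have "\<dots> = 0"
    using left_commute[of "c w" "s v" "s a"] c(1) assms by (auto simp: endo_on_def)
  finally show ?thesis .
qed

text \<open>Modulo this ideal \<open>s\<close> acts trivially, and it is the smallest ideal with this property if \<open>s\<close> maps
  the ring into itself.\<close>

definition displacement :: "('r \<Rightarrow> 'r) \<Rightarrow> 'r set" where
  "displacement s = gen {w - s w | w. w \<in> A}"

lemma displacement_gens: "endo_on s \<Longrightarrow> {w - s w | w. w \<in> A} \<subseteq> A"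
  by (auto simp: endo_on_def)

lemma displacement_ideal: "endo_on s \<Longrightarrow> is_ideal (displacement s)"
  unfolding displacement_def by (intro gen_ideal displacement_gens)

lemma displacement_mult_mem:
  assumes "is_ideal P" "endo_on s" "b \<in> A" "\<And>w. w \<in> A \<Longrightarrow> (w - s w) * b \<in> P"
    and "q \<in> displacement s"
  shows "q * b \<in> P"
  using gen_mult_mem[OF assms(1) displacement_gens[OF assms(2)] assms(3)] assms(4,5)
  unfolding displacement_def by auto

text \<open>Two twisted differences turn an untwisted \<open>F\<close> with derivation part \<open>c\<close> into
  \<open>d v d w F a + (d w c v + d v c w) a\<close>, where \<open>d w = w - s w\<close>. Its derivation part is
  \<open>d v d w c\<close>, so if all its values are multiplied into \<open>P\<close> by \<open>x\<close>, then so are the products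
  \<open>d v d w c u\<close>. A third factor from the displacement ideal therefore
  removes the terms with \<open>c\<close> and leaves a multiple of \<open>F a\<close> alone.\<close>

lemma eliminate_one:
  assumes P: "is_ideal P" and F: "first_order (\<lambda>x. x) F" and s: "endo_on s" and x: "x \<in> A"
    and IH: "\<And>w v a. w \<in> A \<Longrightarrow> v \<in> A \<Longrightarrow> a \<in> A \<Longrightarrow>
      twisted_diff s v (twisted_diff s w F) a * x \<in> P"
    and q: "q1 \<in> displacement s" "q2 \<in> displacement s" "q3 \<in> displacement s" and a: "a \<in> A"
  shows "F a * (q1 * (q2 * (q3 * x))) \<in> P"
proof -
  obtain c where c: "\<And>w. w \<in> A \<Longrightarrow> c w \<in> A"
      "\<And>w a. w \<in> A \<Longrightarrow> a \<in> A \<Longrightarrow> F (w * a) = w * F a + c w * a"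
    and FA: "\<And>a. a \<in> A \<Longrightarrow> F a \<in> A"
    using F unfolding first_order_def by metis
  define d where "d w = w - s w" for w
  have dA: "d w \<in> A" if "w \<in> A" for w using that s by (auto simp: d_def endo_on_def)
  have sA: "s w \<in> A" if "w \<in> A" for w using that s by (auto simp: endo_on_def)
  have one: "twisted_diff s w F a = d w * F a + c w * a" if "w \<in> A" "a \<in> A" for w a
    using c(2)[OF that] by (simp add: twisted_diff_def d_def algebra_simps)
  have two: "twisted_diff s v (twisted_diff s w F) a =
      d v * (d w * F a) + d w * (c v * a) + d v * (c w * a)"
    if "w \<in> A" "v \<in> A" "a \<in> A" for w v a
  proof -
    have "twisted_diff s v (twisted_diff s w F) a =
      d w * (v * F a + c v * a) + c w * (v * a) - s v * (d w * F a + c w * a)"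
      using one[of w "v * a"] one[of w a] c(2)[of v a] that
      unfolding twisted_diff_def[of s v] by simp
    moreover have "d w * (v * F a) = v * (d w * F a)" "c w * (v * a) = v * (c w * a)"
      using left_commute that dA c by auto
    moreover have "s v = v - d v" by (simp add: d_def)
    ultimately show ?thesis by (simp add: algebra_simps)
  qed
  have memP: "(d v * (d w * F a) + d w * (c v * a) + d v * (c w * a)) * x \<in> P"
    if "w \<in> A" "v \<in> A" "a \<in> A" for w v a
    using IH[OF that] two[OF that] by simp
  \<comment> \<open>The coefficients \<open>c u\<close> are \<open>F u - u F 1\<close>, so they are controlled first.\<close>
  have coeff: "d v * (d w * (c u * x)) \<in> P" if u: "u \<in> A" and w: "w \<in> A" and v: "v \<in> A" for u v w
  proof -
    let ?E = "\<lambda>a. d v * (d w * F a) + d w * (c v * a) + d v * (c w * a)"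
    have "F u = c u + u * F 1" using c(2)[OF u, of 1] by (simp add: add.commute)
    then have E: "d v * (d w * c u) = ?E u - u * ?E 1"
      using left_commute[of u "d v"] left_commute[of u "d w"] commute[of u "c v"] commute[of u "c w"]
        u w v dA c(1) FA by (simp add: algebra_simps)
    have "d v * (d w * c u) * x = ?E u * x - u * (?E 1 * x)"
      unfolding E left_diff_distrib mult.assoc ..
    moreover have "?E u * x \<in> P" "?E 1 * x \<in> P" using memP[OF w v u] memP[OF w v one_mem] .
    ultimately have "d v * (d w * c u) * x \<in> P"
      using P u by (simp add: ideal_diff ideal_mult_left)
    then show ?thesis by (simp add: mult.assoc)
  qed
  have qA: "q1 \<in> A" "q2 \<in> A" "q3 \<in> A"
    using q displacement_ideal[OF s] ideal_mem by auto
  \<comment> \<open>A factor from the displacement ideal kills the terms containing \<open>c\<close>.\<close>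
  have kill: "q1 * (d w * (c u * (a * x))) \<in> P" if "w \<in> A" "u \<in> A" for w u
  proof (rule displacement_mult_mem[OF P s _ _ q(1)])
    show "d w * (c u * (a * x)) \<in> A" using that dA c a x by auto
    fix v assume v: "v \<in> A"
    have "(v - s v) * (d w * (c u * (a * x))) = a * (d v * (d w * (c u * x)))"
      using left_commute[of a "d v"] left_commute[of a "d w"] left_commute[of a "c u"]
        that v a dA c(1) by (simp add: d_def)
    then show "(v - s v) * (d w * (c u * (a * x))) \<in> P"
      using coeff[OF that(2,1) v] P a by (simp add: ideal_mult_left)
  qed
  have gens: "d v * (d w * (q1 * (F a * x))) \<in> P" if w: "w \<in> A" and v: "v \<in> A" for w v
  proof -
    have "d v * (d w * (q1 * (F a * x))) =
      q1 * ((d v * (d w * F a) + d w * (c v * a) + d v * (c w * a)) * x)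
      - q1 * (d w * (c v * (a * x))) - q1 * (d v * (c w * (a * x)))"
      using left_commute[of q1 "d v"] left_commute[of q1 "d w"] qA w v dA
      by (simp add: algebra_simps)
    then show ?thesis
      using memP[OF w v a] kill[OF w v] kill[OF v w] P qA by (simp add: ideal_diff ideal_mult_left)
  qed
  have kill3: "q3 * (d w * (q1 * (F a * x))) \<in> P" if w: "w \<in> A" for w
    using gens[OF w] w dA qA FA a x unfolding d_def
    by (intro displacement_mult_mem[OF P s _ _ q(3)]) auto
  have "d w * (q3 * (q1 * (F a * x))) \<in> P" if w: "w \<in> A" for w
    using kill3[OF w] left_commute[OF qA(3) dA[OF w]] by simp
  then have "q2 * (q3 * (q1 * (F a * x))) \<in> P"
    using qA FA a x unfolding d_def
    by (intro displacement_mult_mem[OF P s _ _ q(2)]) auto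
  moreover have "F a * (q1 * (q2 * (q3 * x))) = q2 * (q3 * (q1 * (F a * x)))"
    using left_commute[of "F a" q1] left_commute[of "F a" q2] left_commute[of "F a" q3]
      left_commute[of q1 q2] left_commute[of q1 q3] qA FA[OF a] by simp
  ultimately show ?thesis by simp
qed

text \<open>Each \<open>k \<in> U\<close> costs three factors from \<open>X\<close>. Two twisted differences with the twist of \<open>k\<close> delete
  the summand of \<open>k\<close> and keep the shape of all others, so the induction hypothesis
  applies to what is left, and \<open>eliminate_one\<close> leads back to \<open>F\<close>.\<close>

lemma eliminate:
  assumes "finite U" "is_ideal P" "X \<subseteq> A"
    and "\<And>k. k \<in> U \<Longrightarrow> endo_on (s k)" "\<And>k. k \<in> U \<Longrightarrow> X \<subseteq> displacement (s k)"
    and "first_order (\<lambda>x. x) F" "\<And>k. k \<in> U \<Longrightarrow> first_order (s k) (Fs k)"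
    and "\<And>a. a \<in> A \<Longrightarrow> F a + (\<Sum>k\<in>U. Fs k a) \<in> P"
    and "a \<in> A" "set xs \<subseteq> X" "length xs = 3 * card U"
  shows "F a * prod_list xs \<in> P"
  using assms(1,4-)
proof (induction U arbitrary: F Fs a xs rule: finite_induct)
  case empty
  then show ?case by simp
next
  case (insert g U)
  note prems = insert.prems
  have g: "endo_on (s g)" "first_order (s g) (Fs g)" "X \<subseteq> displacement (s g)" using prems by auto
  have "length xs = Suc (Suc (Suc (3 * card U)))"
    using prems insert.hyps by simp
  then obtain q1 q2 q3 ys where xs: "xs = q1 # q2 # q3 # ys" "length ys = 3 * card U"
    by (metis (no_types) length_Suc_conv)
  have "prod_list ys \<in> A"
    using prems assms(3) xs by (intro prod_list_mem) auto
  moreover have "twisted_diff (s g) v (twisted_diff (s g) w F) b * prod_list ys \<in> P"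
    if w: "w \<in> A" and v: "v \<in> A" and b: "b \<in> A" for w v b
  proof (rule insert.IH[where F = "twisted_diff (s g) v (twisted_diff (s g) w F)" and Fs = "\<lambda>k. twisted_diff (s g) v (twisted_diff (s g) w (Fs k))"])
    let ?D = "\<lambda>F. twisted_diff (s g) v (twisted_diff (s g) w F)"
    show "first_order (\<lambda>x. x) (?D F)"
      using prems g w v by (intro first_order_twisted_diff) (auto simp: endo_on_def)
    show "first_order (s k) (?D (Fs k))" if "k \<in> U" for k
      using that prems g w v by (intro first_order_twisted_diff) auto
    fix a assume a: "a \<in> A"
    define S where "S a = F a + (\<Sum>k\<in>insert g U. Fs k a)" for a
    have SP: "S b \<in> P" if "b \<in> A" for b using prems(5)[OF that] by (simp add: S_def)
    have sA: "s g w \<in> A" "s g v \<in> A" using g w v by (auto simp: endo_on_def)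
    have D: "?D F a = F (w * (v * a)) - s g w * F (v * a) - s g v * F (w * a)
      + s g v * (s g w * F a)" for F
      by (simp add: twisted_diff_def algebra_simps)
    have "?D F a + (\<Sum>k\<in>U. ?D (Fs k) a) = ?D F a + (\<Sum>k\<in>insert g U. ?D (Fs k) a)"
      using twisted_diff_twice[OF g(2,1) w v a] insert.hyps by simp
    also have "\<dots> = ?D S a"
      unfolding D S_def by (simp add: sum.distrib sum_subtractf sum_distrib_left algebra_simps
        del: sum.insert)
    also have "\<dots> \<in> P"
      unfolding D using assms(2) is_ideal_A w v a sA
      by (intro ideal_add ideal_diff ideal_mult_left SP) auto
    finally show "?D F a + (\<Sum>k\<in>U. ?D (Fs k) a) \<in> P" .
  qed (use prems b xs in auto)
  ultimately show ?case
    using eliminate_one[OF assms(2) prems(3) g(1), of "prod_list ys" q1 q2 q3 a]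
      prems(6,7) subsetD[OF g(3)] xs by auto
qed

end

section \<open>The ring of additive endomorphisms\<close>

typedef (overloaded) 'a endo = "{f :: 'a::ab_group_add \<Rightarrow> 'a. \<forall>x y. f (x + y) = f x + f y}"
  morphisms app Endo
  by (rule exI[of _ "\<lambda>x. x"]) simp

lemma app_Endo: "(\<And>x y. f (x + y) = f x + f y) \<Longrightarrow> app (Endo f) = f"
  by (simp add: Endo_inverse)

lemma app_add: "app f (x + y) = app f x + app f y"
  using app[of f] by simp

lemma app_zero: "app f 0 = 0"
  using app_add[of f 0 0] by simp

lemma endo_eqI: "(\<And>x. app f x = app g x) \<Longrightarrow> f = g"
  using app_inject by blast

instantiation endo :: (ab_group_add) "{ring, monoid_mult}"
begin

definition "0 = Endo (\<lambda>x. 0)"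
definition "1 = Endo (\<lambda>x. x)"
definition "f + g = Endo (\<lambda>x. app f x + app g x)"
definition "- f = Endo (\<lambda>x. - app f x)"
definition "f - g = Endo (\<lambda>x. app f x - app g x)"
definition "f * g = Endo (\<lambda>x. app f (app g x))"

lemma app_ops:
  "app 0 x = 0" "app 1 x = x" "app (f + g) x = app f x + app g x" "app (- f) x = - app f x"
  "app (f - g) x = app f x - app g x" "app (f * g) x = app f (app g x)"
  by (simp_all add: zero_endo_def one_endo_def plus_endo_def uminus_endo_def minus_endo_def
      times_endo_def app_Endo app_add)

instance
  by standard (auto intro!: endo_eqI simp: app_ops app_add algebra_simps)

end

lemma app_sum_right: "app f (\<Sum>i\<in>S. g i) = (\<Sum>i\<in>S. app f (g i))"
  by (induction S rule: infinite_finite_induct) (auto simp: app_zero app_add)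

section \<open>Multiplication operators of a Novikov algebra\<close>

context nonassoc_algebra
begin

lemma mul_add_left: "(x + y) \<cdot> z = x \<cdot> z + y \<cdot> z"
  using linear_mul_left[of z] by (simp add: Vector_Spaces.linear_iff)

lemma mul_add_right: "x \<cdot> (y + z) = x \<cdot> y + x \<cdot> z"
  using linear_mul_right[of x] by (simp add: Vector_Spaces.linear_iff)

lemma mul_scale_left: "(c *s x) \<cdot> y = c *s (x \<cdot> y)"
  using linear_mul_left[of y] by (simp add: Vector_Spaces.linear_iff)

definition Rop :: "'a \<Rightarrow> 'a endo" where "Rop y = Endo (\<lambda>w. w \<cdot> y)"
definition Lop :: "'a \<Rightarrow> 'a endo" where "Lop y = Endo (\<lambda>w. y \<cdot> w)"

lemma app_Rop: "app (Rop y) w = w \<cdot> y"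
  unfolding Rop_def by (simp add: app_Endo mul_add_left)

lemma app_Lop: "app (Lop y) w = y \<cdot> w"
  unfolding Lop_def by (simp add: app_Endo mul_add_right)

lemma Rop_add: "Rop (x + y) = Rop x + Rop y"
  by (rule endo_eqI) (simp add: app_Rop app_ops mul_add_right)

lemma Lop_add: "Lop (x + y) = Lop x + Lop y"
  by (rule endo_eqI) (simp add: app_Lop app_ops mul_add_left)

lemma Rop_zero: "Rop 0 = 0"
  using Rop_add[of 0 0] by simp

lemma Rop_diff: "Rop (x - y) = Rop x - Rop y"
  using Rop_add[of "x - y" y] by simp

lemma Lop_diff: "Lop (x - y) = Lop x - Lop y"
  using Lop_add[of "x - y" y] by simp

lemma Rop_sum: "Rop (\<Sum>i\<in>S. f i) = (\<Sum>i\<in>S. Rop (f i))"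
  by (induction S rule: infinite_finite_induct) (auto simp: Rop_zero Rop_add)

lemma set_prod_mem: "u \<in> U \<Longrightarrow> v \<in> V \<Longrightarrow> u \<cdot> v \<in> set_prod U V"
  unfolding set_prod_def by (rule span_base) auto

inductive_set Ralg :: "'a endo set" where
  one: "1 \<in> Ralg"
| Rop: "Rop y \<in> Ralg"
| plus: "f \<in> Ralg \<Longrightarrow> g \<in> Ralg \<Longrightarrow> f + g \<in> Ralg"
| uminus: "f \<in> Ralg \<Longrightarrow> - f \<in> Ralg"
| mult: "f \<in> Ralg \<Longrightarrow> g \<in> Ralg \<Longrightarrow> f * g \<in> Ralg"

definition ad :: "'a \<Rightarrow> 'a endo \<Rightarrow> 'a endo" where
  "ad y f = Lop y * f - f * Lop y"

lemma ad_mult: "ad y (f * g) = ad y f * g + f * ad y g"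
  by (simp add: ad_def algebra_simps)

end

context novikov_algebra
begin

lemma Rop_commute: "Rop x * Rop y = Rop y * Rop x"
  by (rule endo_eqI) (simp add: app_Rop app_ops right_commutative)

lemma Rop_Lop: "Rop z * Lop y = Lop (y \<cdot> z)"
  by (rule endo_eqI) (simp add: app_Rop app_Lop app_ops right_commutative)

text \<open>Left symmetry in operator form.\<close>

lemma ad_Rop: "ad y (Rop z) = Rop (y \<cdot> z) - Rop y * Rop z"
proof (rule endo_eqI)
  fix w
  have "(y \<cdot> w) \<cdot> z - y \<cdot> (w \<cdot> z) = (w \<cdot> y) \<cdot> z - w \<cdot> (y \<cdot> z)"
    using left_symmetric[of y w z] by (simp add: associator_def)
  then have "y \<cdot> (w \<cdot> z) - (y \<cdot> w) \<cdot> z = w \<cdot> (y \<cdot> z) - (w \<cdot> y) \<cdot> z"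
    by (simp add: algebra_simps)
  then show "app (ad y (Rop z)) w = app (Rop (y \<cdot> z) - Rop y * Rop z) w"
    by (simp add: ad_def app_ops app_Rop app_Lop right_commutative[of w z y])
qed

lemma Ralg_commute_Rop: "f \<in> Ralg \<Longrightarrow> f * Rop y = Rop y * f"
proof (induction rule: Ralg.induct)
  case (mult f g)
  then show ?case by (metis mult.assoc)
qed (simp_all add: algebra_simps Rop_commute)

lemma Ralg_commute: "f \<in> Ralg \<Longrightarrow> g \<in> Ralg \<Longrightarrow> f * g = g * f"
proof (induction rule: Ralg.induct)
  case (mult f h)
  then show ?case by (metis mult.assoc)
qed (simp_all add: algebra_simps Ralg_commute_Rop)

sublocale R: comm_subring Ralg
  by standard (auto intro: Ralg.intros Ralg_commute)

text \<open>This makes \<open>ad\<close> linear over the ring: \<open>ad (g y) = g ad y\<close>, since \<open>g\<close> commutes with the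
  operators that \<open>ad\<close> is applied to.\<close>

lemma Ralg_Lop: "f \<in> Ralg \<Longrightarrow> f * Lop y = Lop (app f y)"
proof (induction arbitrary: y rule: Ralg.induct)
  case (uminus f)
  have "Lop (- app f y) = - Lop (app f y)"
    using Lop_diff[of 0 "app f y"] Lop_diff[of 0 0] by simp
  then show ?case using uminus by (simp add: app_ops)
qed (simp_all add: app_ops app_Rop Rop_Lop Lop_add algebra_simps)

lemma ad_Ralg: "f \<in> Ralg \<Longrightarrow> ad y f \<in> Ralg"
proof (induction rule: Ralg.induct)
  case one
  then show ?case by (simp add: ad_def)
next
  case (Rop z)
  then show ?case by (simp add: ad_Rop Ralg.Rop)
next
  case (plus f g)
  have "ad y (f + g) = ad y f + ad y g" by (simp add: ad_def algebra_simps)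
  then show ?case using plus by simp
next
  case (uminus f)
  have "ad y (- f) = - ad y f" by (simp add: ad_def)
  then show ?case using uminus by simp
next
  case (mult f g)
  then show ?case by (simp add: ad_mult)
qed

text \<open>The central formula: \<open>f \<mapsto> R (f y)\<close> is a first-order differential operator. It holds for
  \<open>f = R z\<close> by left symmetry and passes to products by the Leibniz rule.\<close>

lemma Rop_app:
  "f \<in> Ralg \<Longrightarrow> Rop (app f y) = f * Rop y + ad y f"
proof (induction arbitrary: y rule: Ralg.induct)
  case one
  then show ?case by (simp add: ad_def app_ops)
next
  case (Rop z)
  then show ?case by (simp add: ad_Rop app_Rop Rop_commute)
next
  case (plus f g)
  then show ?case by (simp add: app_ops Rop_add ad_def algebra_simps)
next
  case (uminus f)
  have "Rop (- app f y) = - Rop (app f y)"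
    using Rop_diff[of 0 "app f y"] by (simp add: Rop_zero)
  then show ?case using uminus by (simp add: app_ops ad_def)
next
  case (mult f g)
  have "f * (g * Lop y) = g * (f * Lop y)"
    using Ralg_commute[OF mult.hyps] by (metis mult.assoc)
  then have "ad (app g y) f = g * ad y f"
    unfolding ad_def Ralg_Lop[OF mult.hyps(2), symmetric] by (simp add: algebra_simps)
  then show ?case
    using mult Ralg_commute[OF mult.hyps(2) ad_Ralg[OF mult.hyps(1), of y]]
    by (simp add: app_ops ad_mult algebra_simps)
qed

lemma Rop_range: "Rop ` B \<subseteq> Ralg"
  by (auto intro: Ralg.Rop)

text \<open>Computing \<open>ad (b c) (R d) = R c (ad b (R d))\<close> in two ways by left symmetry. For elements of a
  subalgebra, every term on the right contains the operator of a product.\<close>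

lemma Rop_triple:
  "Rop c * Rop b * Rop d = Rop c * Rop (b \<cdot> d) + Rop (b \<cdot> c) * Rop d - Rop ((b \<cdot> c) \<cdot> d)"
proof -
  have "Rop d * (Rop c * Lop b) = Rop c * (Rop d * Lop b)"
    using Rop_commute[of c d] by (metis mult.assoc)
  then have "ad (b \<cdot> c) (Rop d) = Rop c * ad b (Rop d)"
    unfolding ad_def Rop_Lop[symmetric] by (simp add: algebra_simps)
  then show ?thesis by (simp add: ad_Rop algebra_simps)
qed

lemma nil_mod_square:
  assumes "set_prod B B \<subseteq> B"
  shows "R.nil_mod (R.gen (Rop ` B)) (R.gen (Rop ` set_prod B B))"
proof -
  let ?P = "R.gen (Rop ` set_prod B B)"
  have P: "R.is_ideal ?P" using Rop_range by (rule R.gen_ideal)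
  have in_P: "Rop (b \<cdot> c) \<in> ?P" if "b \<in> B" "c \<in> B" for b c
    using set_prod_mem[OF that] R.subset_gen by blast
  have "prod_list xs \<in> ?P" if xs: "length xs = 3" "set xs \<subseteq> Rop ` B" for xs
  proof -
    obtain c b d where [simp]: "xs = [Rop c, Rop b, Rop d]" and B: "c \<in> B" "b \<in> B" "d \<in> B"
      using xs by (auto simp: numeral_3_eq_3 length_Suc_conv)
    have bc: "b \<cdot> c \<in> B" using assms set_prod_mem B by blast
    have "Rop c * Rop b * Rop d \<in> ?P"
      unfolding Rop_triple using in_P B bc P
      by (intro R.ideal_diff R.ideal_add R.ideal_mult_left R.ideal_mult_right)
        (auto intro: Ralg.Rop)
    then show ?thesis by (simp add: mult.assoc)
  qed
  then have "R.nil_mod (Rop ` B) ?P" unfolding R.nil_mod_def by blast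
  then show ?thesis using R.nil_mod_gen Rop_range P by blast
qed

lemma derived_power_square_subset:
  assumes "set_prod B B \<subseteq> B"
  shows "set_prod (derived_power B m) (derived_power B m) \<subseteq> derived_power B m"
proof (induction m)
  case (Suc m)
  have "set_prod U U \<subseteq> set_prod V V" if "U \<subseteq> V" for U V
    unfolding set_prod_def using that by (intro span_mono) auto
  then show ?case using Suc by simp
qed (use assms in simp)

lemma solvable_imp_nil_mod:
  assumes "set_prod B B \<subseteq> B" "solvable_alg B"
  shows "R.nil_mod (R.gen (Rop ` B)) {0}"
proof -
  obtain m where m: "derived_power B m = {0}" using assms(2) by (auto simp: solvable_alg_def)
  have step: "R.nil_mod (R.gen (Rop ` derived_power B 0)) (R.gen (Rop ` derived_power B k))" for k
  proof (induction k)
    case 0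
    show ?case unfolding R.nil_mod_def by (rule exI[of _ 1]) (auto simp: length_Suc_conv)
  next
    case (Suc k)
    show ?case
      using R.nil_mod_trans[OF Suc nil_mod_square[OF derived_power_square_subset[OF assms(1)]]] by simp
  qed
  have "R.is_ideal {0}" by (auto intro!: R.is_idealI)
  then have "R.gen (Rop ` derived_power B m) \<subseteq> {0}"
    by (intro R.gen_least) (auto simp: m Rop_zero)
  with step[of m] show ?thesis
    unfolding R.nil_mod_def derived_power.simps(1) by blast
qed

text \<open>If all \<open>m\<close>-fold products of right multiplications vanish, then the \<open>j\<close>-th derived power is
  annihilated by all \<open>(m - j)\<close>-fold ones, as a product \<open>u v\<close> is itself the value of \<open>R v\<close> at \<open>u\<close>.\<close>

lemma nil_mod_imp_solvable:
  assumes "R.nil_mod (R.gen (range Rop)) {0}"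
  shows "solvable_alg UNIV"
proof -
  obtain m where m: "\<And>fs. length fs = m \<Longrightarrow> set fs \<subseteq> range Rop \<Longrightarrow> prod_list fs = 0"
    using assms R.subset_gen[of "range Rop"] unfolding R.nil_mod_def by blast
  define Z where "Z j = {x. \<forall>fs. length fs = m - j \<longrightarrow> set fs \<subseteq> range Rop \<longrightarrow>
    app (prod_list fs) x = 0}" for j
  have scale: "app (prod_list fs) (c *s x) = c *s app (prod_list fs) x"
    if "set fs \<subseteq> range Rop" for fs c x
    using that by (induction fs) (auto simp: app_ops app_Rop mul_scale_left)
  have sub: "subspace (Z j)" for j
    by (rule subspaceI) (auto simp: Z_def app_zero app_add scale)
  have Z: "derived_power UNIV j \<subseteq> Z j" if "j \<le> m" for j
    using that
  proof (induction j)
    case 0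
    then show ?case using m by (auto simp: Z_def app_ops)
  next
    case (Suc j)
    have "u \<cdot> v \<in> Z (Suc j)" if "u \<in> Z j" for u v
    proof -
      have "app (prod_list fs) (u \<cdot> v) = 0"
        if fs: "length fs = m - Suc j" "set fs \<subseteq> range Rop" for fs
      proof -
        have "length (fs @ [Rop v]) = m - j" "set (fs @ [Rop v]) \<subseteq> range Rop"
          using fs Suc.prems by auto
        then have "app (prod_list (fs @ [Rop v])) u = 0"
          using \<open>u \<in> Z j\<close> unfolding Z_def by blast
        then show ?thesis by (simp add: app_ops app_Rop)
      qed
      then show ?thesis by (simp add: Z_def)
    qed
    moreover have "derived_power UNIV j \<subseteq> Z j" using Suc by simp
    ultimately show ?case
      unfolding derived_power.simps set_prod_def by (intro span_minimal sub) auto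
  qed
  have "derived_power UNIV m \<subseteq> {0}"
    using Z[of m] by (auto simp: Z_def app_ops)
  then have "derived_power UNIV (Suc m) \<subseteq> {0}"
    unfolding derived_power.simps set_prod_def
    using app_zero[of "Rop 0"] by (intro span_minimal) (auto simp: app_Rop)
  moreover have "0 \<in> derived_power UNIV (Suc m)"
    by (simp add: set_prod_def span_zero)
  ultimately show ?thesis
    unfolding solvable_alg_def by (intro exI[of _ "Suc m"]) auto
qed

end

section \<open>The action of a group of automorphisms\<close>

context novikov_algebra
begin

lemma auto_add: "\<phi> \<in> alg_auto \<Longrightarrow> \<phi> (x + y) = \<phi> x + \<phi> y"
  and auto_scale: "\<phi> \<in> alg_auto \<Longrightarrow> \<phi> (scale c x) = scale c (\<phi> x)"
  and auto_mul: "\<phi> \<in> alg_auto \<Longrightarrow> \<phi> (mul x y) = mul (\<phi> x) (\<phi> y)"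
  and auto_bij: "\<phi> \<in> alg_auto \<Longrightarrow> bij \<phi>"
  by (auto simp: alg_auto_def Vector_Spaces.linear_iff)

lemma auto_inv:
  assumes "\<phi> \<in> alg_auto"
  shows "\<phi> (inv_into UNIV \<phi> x) = x" "inv_into UNIV \<phi> (\<phi> x) = x"
  using auto_bij[OF assms] by (simp_all add: bij_is_surj surj_f_inv_f bij_is_inj)

lemma auto_inv_add:
  assumes "\<phi> \<in> alg_auto"
  shows "inv_into UNIV \<phi> (x + y) = inv_into UNIV \<phi> x + inv_into UNIV \<phi> y"
  by (metis assms auto_add auto_inv)

lemma auto_zero: "\<phi> \<in> alg_auto \<Longrightarrow> \<phi> 0 = 0"
  using auto_add[of \<phi> 0 0] by simp

lemma auto_sum: "\<phi> \<in> alg_auto \<Longrightarrow> \<phi> (\<Sum>i\<in>S. f i) = (\<Sum>i\<in>S. \<phi> (f i))"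
  by (induction S rule: infinite_finite_induct) (auto simp: auto_zero auto_add)

definition conj_by where
  "conj_by \<phi> f = Endo \<phi> * f * Endo (inv_into UNIV \<phi>)"

lemma app_conj_by:
  assumes "\<phi> \<in> alg_auto"
  shows "app (conj_by \<phi> f) x = \<phi> (app f (inv_into UNIV \<phi> x))"
  using assms by (simp add: conj_by_def app_ops app_Endo auto_add auto_inv_add)

lemma conj_by_mult: "\<phi> \<in> alg_auto \<Longrightarrow> conj_by \<phi> (f * g) = conj_by \<phi> f * conj_by \<phi> g"
  by (rule endo_eqI) (simp add: app_conj_by app_ops auto_inv)

lemma conj_by_add: "\<phi> \<in> alg_auto \<Longrightarrow> conj_by \<phi> (f + g) = conj_by \<phi> f + conj_by \<phi> g"
  by (rule endo_eqI) (simp add: app_conj_by app_ops auto_add)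

lemma conj_by_one: "\<phi> \<in> alg_auto \<Longrightarrow> conj_by \<phi> 1 = 1"
  by (rule endo_eqI) (simp add: app_conj_by app_ops auto_inv)

lemma conj_by_uminus: "\<phi> \<in> alg_auto \<Longrightarrow> conj_by \<phi> (- f) = - conj_by \<phi> f"
  using conj_by_add[of \<phi> f "- f"] conj_by_add[of \<phi> 0 0]
  by (simp add: eq_neg_iff_add_eq_0 add.commute)

lemma conj_by_Rop: "\<phi> \<in> alg_auto \<Longrightarrow> conj_by \<phi> (Rop y) = Rop (\<phi> y)"
  by (rule endo_eqI) (simp add: app_conj_by app_Rop auto_mul auto_inv)

lemma conj_by_comp:
  assumes "\<phi> \<in> alg_auto" "\<psi> \<in> alg_auto" "\<phi> \<circ> \<psi> \<in> alg_auto"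
  shows "conj_by (\<phi> \<circ> \<psi>) f = conj_by \<phi> (conj_by \<psi> f)"
proof (rule endo_eqI)
  fix x
  have "inv_into UNIV (\<phi> \<circ> \<psi>) x = inv_into UNIV \<psi> (inv_into UNIV \<phi> x)"
    using auto_bij assms by (metis comp_apply o_inv_distrib)
  then show "app (conj_by (\<phi> \<circ> \<psi>) f) x = app (conj_by \<phi> (conj_by \<psi> f)) x"
    using assms by (simp add: app_conj_by)
qed

lemma conj_by_id: "conj_by (\<lambda>x. x) f = f"
  by (rule endo_eqI) (simp add: conj_by_def app_ops app_Endo inv_id[unfolded id_def])

lemma conj_by_mem: "f \<in> Ralg \<Longrightarrow> \<phi> \<in> alg_auto \<Longrightarrow> conj_by \<phi> f \<in> Ralg"
  by (induction rule: Ralg.induct)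
    (auto simp: conj_by_one conj_by_Rop conj_by_add conj_by_uminus conj_by_mult intro: Ralg.Rop)

lemma endo_on_conj_by: "\<phi> \<in> alg_auto \<Longrightarrow> R.endo_on (conj_by \<phi>)"
  by (simp add: R.endo_on_def conj_by_mem conj_by_mult)

text \<open>\<open>R (\<phi> (f z))\<close> is the conjugate of \<open>R (f z)\<close>, so the twist is the conjugation by \<open>\<phi>\<close>.\<close>

lemma Rop_auto_first_order:
  assumes "\<phi> \<in> alg_auto"
  shows "R.first_order (conj_by \<phi>) (\<lambda>f. Rop (\<phi> (app f z)))"
  unfolding R.first_order_def
proof (intro conjI exI ballI)
  show "Rop (\<phi> (app a z)) \<in> Ralg" for a by (rule Ralg.Rop)
  show "conj_by \<phi> (ad z w) \<in> Ralg" if "w \<in> Ralg" for w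
    using that assms by (intro conj_by_mem ad_Ralg)
  fix w a assume wa: "w \<in> Ralg" "a \<in> Ralg"
  have "Rop (app (w * a) z) = w * Rop (app a z) + ad z w * a"
    using wa by (simp add: Rop_app ad_mult algebra_simps)
  then show "Rop (\<phi> (app (w * a) z)) =
      conj_by \<phi> w * Rop (\<phi> (app a z)) + conj_by \<phi> (ad z w) * conj_by \<phi> a"
    using assms by (simp add: conj_by_add conj_by_mult flip: conj_by_Rop)
qed

lemma AlgAut_mult:
  "\<phi> \<in> alg_auto \<Longrightarrow> \<psi> \<in> alg_auto \<Longrightarrow> \<phi> \<otimes>\<^bsub>AlgAutGroup\<^esub> \<psi> = \<phi> \<circ> \<psi>"
  by (simp add: AlgAutGroup_def BijGroup_def Bij_def compose_def restrict_UNIV comp_def auto_bij)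

lemma AlgAut_one: "\<one>\<^bsub>AlgAutGroup\<^esub> = (\<lambda>x. x)"
  by (simp add: AlgAutGroup_def BijGroup_def restrict_UNIV)

context
  fixes G
  assumes G: "subgroup G AlgAutGroup" and finG: "finite G"
begin

lemma G_auto: "\<phi> \<in> G \<Longrightarrow> \<phi> \<in> alg_auto"
  using subgroup.subset[OF G] by (auto simp: AlgAutGroup_def)

lemma G_comp: "\<phi> \<in> G \<Longrightarrow> \<psi> \<in> G \<Longrightarrow> \<phi> \<circ> \<psi> \<in> G"
  using subgroup.m_closed[OF G] AlgAut_mult G_auto by metis

lemma invariants_square: "set_prod (invariants G) (invariants G) \<subseteq> invariants G"
  unfolding set_prod_def
proof (rule span_minimal)
  show "subspace (invariants G)"
    by (rule subspaceI) (auto simp: invariants_def auto_zero auto_add auto_scale G_auto)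
  have "u \<cdot> v \<in> invariants G" if "\<forall>\<phi>\<in>G. \<phi> u = u" "\<forall>\<phi>\<in>G. \<phi> v = v" for u v
    unfolding invariants_def
  proof (intro CollectI ballI)
    fix \<phi> assume \<phi>: "\<phi> \<in> G"
    show "\<phi> (u \<cdot> v) = u \<cdot> v"
      using auto_mul[OF G_auto[OF \<phi>], of u v] bspec[OF that(1) \<phi>] bspec[OF that(2) \<phi>] by simp
  qed
  then show "{u \<cdot> v |u v. u \<in> invariants G \<and> v \<in> invariants G} \<subseteq> invariants G"
    unfolding invariants_def by blast
qed

lemma trace_invariant: "(\<Sum>\<phi>\<in>G. \<phi> x) \<in> invariants G"
proof -
  have "\<psi> (\<Sum>\<phi>\<in>G. \<phi> x) = (\<Sum>\<phi>\<in>G. \<phi> x)" if \<psi>: "\<psi> \<in> G" for \<psi>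
  proof -
    have inj: "inj_on (\<lambda>\<phi>. \<psi> \<circ> \<phi>) G"
      using auto_inv(2)[OF G_auto[OF \<psi>]] by (intro inj_onI ext) (metis comp_apply)
    moreover have "(\<lambda>\<phi>. \<psi> \<circ> \<phi>) ` G \<subseteq> G" using \<psi> G_comp by auto
    ultimately have "(\<lambda>\<phi>. \<psi> \<circ> \<phi>) ` G = G" by (simp add: endo_inj_surj finG)
    then have "(\<Sum>\<phi>\<in>G. \<phi> x) = (\<Sum>\<phi>\<in>G. (\<psi> \<circ> \<phi>) x)"
      using sum.reindex[OF inj, of "\<lambda>\<phi>. \<phi> x"] by simp
    then show ?thesis unfolding auto_sum[OF G_auto[OF \<psi>]] comp_def by (rule sym)
  qed
  then show ?thesis by (simp add: invariants_def)
qed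

lemma displacement_subset_iff:
  assumes "R.is_ideal Q"
  shows "R.displacement (conj_by \<phi>) \<subseteq> Q \<longleftrightarrow> (\<forall>w\<in>Ralg. w - conj_by \<phi> w \<in> Q)"
proof
  show "\<forall>w\<in>Ralg. w - conj_by \<phi> w \<in> Q" if "R.displacement (conj_by \<phi>) \<subseteq> Q"
    using subset_trans[OF R.subset_gen that[unfolded R.displacement_def]] by blast
  show "R.displacement (conj_by \<phi>) \<subseteq> Q" if "\<forall>w\<in>Ralg. w - conj_by \<phi> w \<in> Q"
    unfolding R.displacement_def using that by (intro R.gen_least assms) blast
qed

text \<open>The automorphisms that act trivially modulo \<open>Q\<close> form a subgroup, the inertia group, so Lagrange's
  theorem applies; closure under products comes from
  \<open>w - (\<phi> \<psi>) w = (w - \<psi> w) + (\<psi> w - \<phi> (\<psi> w))\<close>.\<close>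

lemma card_inertia_dvd:
  assumes Q: "R.is_ideal Q"
  shows "card {\<phi> \<in> G. R.displacement (conj_by \<phi>) \<subseteq> Q} dvd card G"
proof -
  let ?H = "{\<phi> \<in> G. R.displacement (conj_by \<phi>) \<subseteq> Q}"
  let ?\<Gamma> = "AlgAutGroup\<lparr>carrier := G\<rparr>"
  have grp: "group ?\<Gamma>" using subgroup.subgroup_is_group[OF G group_AlgAutGroup] .
  have H_iff: "\<phi> \<in> ?H \<longleftrightarrow> \<phi> \<in> G \<and> (\<forall>w\<in>Ralg. w - conj_by \<phi> w \<in> Q)" for \<phi>
    using displacement_subset_iff[OF Q] by auto
  have mult: "\<phi> \<otimes>\<^bsub>?\<Gamma>\<^esub> \<psi> = \<phi> \<circ> \<psi>" if "\<phi> \<in> G" "\<psi> \<in> G" for \<phi> \<psi>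
    using that AlgAut_mult G_auto by simp
  have "subgroup ?H ?\<Gamma>"
  proof (rule group.subgroupI[OF grp])
    have "\<one>\<^bsub>AlgAutGroup\<^esub> \<in> G" using subgroup.one_closed[OF G] .
    then have "(\<lambda>x. x) \<in> ?H"
      unfolding H_iff using R.ideal_zero[OF Q] by (simp add: AlgAut_one conj_by_id)
    then show "?H \<noteq> {}" by blast
  next
    fix \<phi> assume \<phi>: "\<phi> \<in> ?H"
    let ?\<psi> = "inv\<^bsub>?\<Gamma>\<^esub> \<phi>"
    have \<psi>: "?\<psi> \<in> G" using group.inv_closed[OF grp] \<phi> by simp
    have "\<phi> \<circ> ?\<psi> = (\<lambda>x. x)"
      using group.r_inv[OF grp, of \<phi>] \<phi> mult[OF _ \<psi>] by (simp add: AlgAut_one)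
    then have inv: "conj_by \<phi> (conj_by ?\<psi> w) = w" for w
      using conj_by_comp[OF G_auto G_auto[OF \<psi>] G_auto[OF G_comp[OF _ \<psi>]], of \<phi> w] \<phi>
      by (simp add: conj_by_id)
    have "w - conj_by ?\<psi> w \<in> Q" if "w \<in> Ralg" for w
    proof -
      have "conj_by ?\<psi> w - conj_by \<phi> (conj_by ?\<psi> w) \<in> Q"
        using \<phi> that conj_by_mem[OF that G_auto[OF \<psi>]] unfolding H_iff by blast
      then show ?thesis using R.ideal_uminus[OF Q] inv by fastforce
    qed
    then show "?\<psi> \<in> ?H" unfolding H_iff using \<psi> by simp
  next
    fix \<phi> \<psi> assume H: "\<phi> \<in> ?H" "\<psi> \<in> ?H"
    have "w - conj_by (\<phi> \<circ> \<psi>) w \<in> Q" if "w \<in> Ralg" for w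
    proof -
      have "w - conj_by (\<phi> \<circ> \<psi>) w =
          (w - conj_by \<psi> w) + (conj_by \<psi> w - conj_by \<phi> (conj_by \<psi> w))"
        using H by (simp add: conj_by_comp G_auto G_comp)
      also have "\<dots> \<in> Q"
        using H that conj_by_mem[OF that G_auto] unfolding H_iff
        by (intro R.ideal_add[OF Q]) auto
      finally show ?thesis .
    qed
    then show "\<phi> \<otimes>\<^bsub>?\<Gamma>\<^esub> \<psi> \<in> ?H"
      unfolding H_iff using H G_comp mult by simp
  qed auto
  from group.lagrange[OF grp this] have "card G = card (rcosets\<^bsub>?\<Gamma>\<^esub> ?H) * card ?H"
    by (simp add: order_def)
  then show ?thesis by (rule dvdI[OF trans[OF _ mult.commute]])
qed

text \<open>With \<open>n\<close> the order of the inertia group \<open>H\<close> and \<open>z = y / n\<close>, the terms \<open>R (h (f z))\<close> for \<open>h \<in> H\<close>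
  add up to \<open>R (f y)\<close> modulo \<open>Q\<close>, and the trace of \<open>f z\<close> is invariant. So \<open>R (f y)\<close> plus
  the twisted terms outside \<open>H\<close> lies in \<open>Q\<close>; these terms are eliminated using factors from \<open>Y\<close>.\<close>

lemma nil_mod_inertia:
  assumes Y: "R.is_ideal Y" and Q: "R.is_ideal Q" and YR: "Y \<subseteq> R.gen (range Rop)"
    and inv: "R.gen (Rop ` invariants G) \<subseteq> Q"
    and dich: "\<And>g. g \<in> G \<Longrightarrow> Y \<subseteq> R.displacement (conj_by g) \<or> R.displacement (conj_by g) \<subseteq> Q"
    and char: "\<And>n. n dvd card G \<Longrightarrow> \<exists>c. scale (of_nat n) \<circ> scale c = id"
  shows "R.nil_mod Y Q"
proof -
  define H where "H = {\<phi> \<in> G. R.displacement (conj_by \<phi>) \<subseteq> Q}"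
  obtain c where c: "scale (of_nat (card H)) \<circ> scale c = id"
    using char card_inertia_dvd[OF Q] unfolding H_def by blast
  have HG: "H \<subseteq> G" by (auto simp: H_def)
  have key: "Rop y * prod_list xs \<in> Q" if xs: "set xs \<subseteq> Y" "length xs = 3 * card (G - H)" for y xs
  proof -
    define z where "z = scale c y"
    have y: "y = (\<Sum>h\<in>H. z)"
      using c by (simp add: z_def sum_constant_scale fun_eq_iff)
    have "Rop (app a y) + (\<Sum>k\<in>G - H. Rop (k (app a z))) \<in> Q" if a: "a \<in> Ralg" for a
    proof -
      have "Rop (\<Sum>g\<in>G. g (app a z)) \<in> Q"
        using inv R.subset_gen trace_invariant by blast
      moreover have "(\<Sum>h\<in>H. Rop (app a z) - conj_by h (Rop (app a z))) \<in> Q"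
        using displacement_subset_iff[OF Q] Ralg.Rop by (intro R.ideal_sum Q) (auto simp: H_def)
      moreover have "Rop (app a y) + (\<Sum>k\<in>G - H. Rop (k (app a z))) =
          Rop (\<Sum>g\<in>G. g (app a z)) + (\<Sum>h\<in>H. Rop (app a z) - conj_by h (Rop (app a z)))"
      proof -
        have "Rop (\<Sum>g\<in>G. g (app a z)) =
            (\<Sum>k\<in>G - H. Rop (k (app a z))) + (\<Sum>h\<in>H. Rop (h (app a z)))"
          using sum.subset_diff[OF HG finG] by (simp add: Rop_sum)
        moreover have "(\<Sum>h\<in>H. conj_by h (Rop (app a z))) = (\<Sum>h\<in>H. Rop (h (app a z)))"
          using HG G_auto by (intro sum.cong) (auto simp: conj_by_Rop)
        moreover have "Rop (app a y) = (\<Sum>h\<in>H. Rop (app a z))"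
          unfolding y app_sum_right Rop_sum ..
        ultimately show ?thesis by (simp add: sum_subtractf)
      qed
      ultimately show ?thesis using R.ideal_add[OF Q] by simp
    qed
    moreover have "R.first_order (\<lambda>x. x) (\<lambda>a. Rop (app a y))"
      using Rop_auto_first_order[of "\<lambda>x. x" y] subgroup.one_closed[OF G] G_auto
      by (simp add: AlgAut_one conj_by_id[abs_def])
    moreover have "Y \<subseteq> R.displacement (conj_by k)" if "k \<in> G - H" for k
      using dich that by (auto simp: H_def)
    ultimately have "Rop (app 1 y) * prod_list xs \<in> Q"
    proof (intro R.eliminate[where U = "G - H" and X = Y and s = conj_by and a = 1
          and F = "\<lambda>a. Rop (app a y)" and Fs = "\<lambda>k a. Rop (k (app a z))"])
      show "R.endo_on (conj_by k)" if "k \<in> G - H" for k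
        using that by (intro endo_on_conj_by G_auto) simp
      show "R.first_order (conj_by k) (\<lambda>a. Rop (k (app a z)))" if "k \<in> G - H" for k
        using that by (intro Rop_auto_first_order G_auto) simp
    qed (use finG Q R.ideal_subset[OF Y] xs R.one_mem in \<open>simp_all only: finite_Diff\<close>)
    then show ?thesis by (simp add: app_ops)
  qed
  have "prod_list xs \<in> Q" if xs: "set xs \<subseteq> Y" "length xs = Suc (3 * card (G - H))" for xs
  proof -
    obtain x xs' where [simp]: "xs = x # xs'" using xs by (cases xs) auto
    have "x * prod_list xs' \<in> Q"
    proof (rule R.gen_mult_mem[OF Q])
      show "range Rop \<subseteq> Ralg" by (rule Rop_range)
      show "prod_list xs' \<in> Ralg"
        using xs R.ideal_subset[OF Y] by (intro R.prod_list_mem) auto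
      show "x \<in> R.gen (range Rop)" using xs YR by auto
    qed (use xs key in auto)
    then show ?thesis by simp
  qed
  then show ?thesis unfolding R.nil_mod_def by blast
qed

text \<open>Invertibility of the divisors of \<open>|G|\<close> is expressed by scalars, because it is used only to divide
  elements of the algebra by the order of an inertia group.\<close>

lemma solvable_of_solvable_invariants:
  assumes "solvable_alg (invariants G)"
    and "\<And>n. n dvd card G \<Longrightarrow> \<exists>c. scale (of_nat n) \<circ> scale c = id"
  shows "solvable_alg UNIV"
proof (rule nil_mod_imp_solvable, rule R.nil_mod_trans)
  show "R.nil_mod (R.gen (Rop ` invariants G)) {0}"
    using invariants_square assms(1) by (rule solvable_imp_nil_mod)
  show "R.nil_mod (R.gen (range Rop)) (R.gen (Rop ` invariants G))"
  proof (rule R.nil_mod_dichotomy[OF finG])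
    show "R.is_ideal (R.gen (range Rop))" "R.is_ideal (R.gen (Rop ` invariants G))"
      by (intro R.gen_ideal Rop_range)+
    show "R.is_ideal (R.displacement (conj_by g))" if "g \<in> G" for g
      using that by (intro R.displacement_ideal endo_on_conj_by G_auto)
    fix Y Q
    assume "R.is_ideal Y" "R.is_ideal Q" "Y \<subseteq> R.gen (range Rop)"
      "R.gen (Rop ` invariants G) \<subseteq> Q"
      "\<And>g. g \<in> G \<Longrightarrow> Y \<subseteq> R.displacement (conj_by g) \<or> R.displacement (conj_by g) \<subseteq> Q"
    then show "R.nil_mod Y Q" using assms(2) by (rule nil_mod_inertia)
  qed
qed

end

end

theorem theorem3:
  fixes scale :: "'k::field \<Rightarrow> 'a::ab_group_add \<Rightarrow> 'a"
    and mul :: "'a \<Rightarrow> 'a \<Rightarrow> 'a"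
    and G :: "('a \<Rightarrow> 'a) set"
  assumes "novikov_algebra scale mul"
    and "subgroup G (nonassoc_algebra.AlgAutGroup scale mul)"
    and "finite G"
    and "solvable (nonassoc_algebra.AlgAutGroup scale mul \<lparr>carrier := G\<rparr>)"
    and "nonassoc_algebra.solvable_alg scale mul (invariants G)"
    and "\<not> CHAR('k) dvd card G"
  shows "nonassoc_algebra.solvable_alg scale mul UNIV"
proof -
  interpret N: novikov_algebra scale mul by (rule assms(1))
  show ?thesis
  proof (rule N.solvable_of_solvable_invariants[OF assms(2,3,5)])
    fix n assume "n dvd card G"
    then have "(of_nat n :: 'k) \<noteq> 0"
      using assms(6) by (meson dvd_trans of_nat_eq_0_iff_char_dvd)
    then have "scale (of_nat n) \<circ> scale (inverse (of_nat n)) = id"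
      by (simp add: fun_eq_iff)
    then show "\<exists>c. scale (of_nat n) \<circ> scale c = id" ..
  qed
qed

end
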